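(* Let $n\ge 1$, let $T>0$, let $G \in \mathcal{G}^n$ be a graph, and let $\mathcal{K} : \mathcal{G}^n \to 2^{\mathbb{S}^n}$ be a set-valued map such that $\mathcal{K}(H)$ is a nonempty subset of $\mathcal{Q}(H)$ for every $H \in \mathcal{G}^n$. Let $X \in \mathcal{K}(G)$ and $x_0 \in \mathbb{R}^n$. Then the network reconstruction problem is solvable for $(x_0,X,\mathcal{K})$ if and only if for all $\bar{X} \in \operatorname{im} \mathcal{K} \setminus \{X\}$ we have $$x_0 \notin \langle \ker(\bar{X} - X) \mid X \rangle.$$
   Context: $\mathbb{S}^n$ is the set of real symmetric $n\times n$ matrices. $\mathcal{G}^n$ is the set of simple undirected graphs (no self-loops, at most one edge between any pair of vertices) with vertex set $V=\{1,\dots,n\}$. For $G\in\mathcal{G}^n$ with edge set $E$, the qualitative class is $\mathcal{Q}(G) := \{X \in \mathbb{S}^n \mid \text{for all } i \neq j,\ X_{ij} \neq 0 \iff (i,j) \in E\}$. The image of a set-valued map $\mathcal{K} : \mathcal{G}^n \to 2^{\mathbb{S}^n}$ is $\operatorname{im}\mathcal{K} := \{Y \in \mathbb{S}^n \mid \exists\, G\in\mathcal{G}^n \text{ such that } Y \in \mathcal{K}(G)\}$. For matrices $C\in\mathbb{R}^{p\times n}$, $A\in\mathbb{R}^{n\times n}$, $\langle \ker C \mid A\rangle := \bigcap_{i=0}^{n-1} \ker(CA^i)$. Solvability: for $x_0\in\mathbb{R}^n$ and $X\in\operatorname{im}\mathcal{K}$, let $x_{x_0}(t)=e^{Xt}x_0$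 be the solution of $\dot x(t)=Xx(t)$ for $t\ge 0$, $x(0)=x_0$. The network reconstruction problem is said to be solvable for $(x_0,X,\mathcal{K})$ if for every $\bar X\in\operatorname{im}\mathcal{K}$ such that $x_{x_0}(\cdot)$ is a solution to $\dot x(t)=\bar X x(t)$ for $t\in[0,T]$, we have $\bar X=X$. Here $T>0$ is a fixed real number. *)

theory Defs
  imports "HOL-Analysis.Analysis"
begin

text \<open>
  Dimension \<open>n\<close> is the cardinality of a finite index type \<open>'n\<close>, which also serves as the
  vertex set. A simple undirected graph on all of \<open>'n\<close> is thus determined by its symmetric,
  irreflexive adjacency relation, so graphs are identified with their edge relations.
\<close>

definition simple_graphs :: "('n \<times> 'n) set set" where
  "simple_graphs = {E. sym E \<and> irrefl E}"

definition symmetric_matrices :: "(real ^ 'n ^ 'n) set" where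
  "symmetric_matrices = {X. transpose X = X}"

definition qualitative_class :: "('n \<times> 'n) set \<Rightarrow> (real ^ 'n ^ 'n) set" where
  "qualitative_class E =
    {X \<in> symmetric_matrices. \<forall>i j. i \<noteq> j \<longrightarrow> (X $ i $ j \<noteq> 0 \<longleftrightarrow> (i, j) \<in> E)}"

text \<open>
  A map on graphs is modelled by a total function on relations; only its values on
  \<open>simple_graphs\<close> are ever used.
\<close>

definition map_image :: "(('n \<times> 'n) set \<Rightarrow> (real ^ 'n ^ 'n) set) \<Rightarrow> (real ^ 'n ^ 'n) set" where
  "map_image K = {Y \<in> symmetric_matrices. \<exists>E\<in>simple_graphs. Y \<in> K E}"

text \<open>
  The library's \<open>A ^ k\<close> and \<open>A * B\<close> act componentwise on vectors of vectors, so powers with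
  respect to the matrix product \<open>**\<close> need their own definition.
\<close>

primrec matrix_power :: "real ^ 'n ^ 'n \<Rightarrow> nat \<Rightarrow> real ^ 'n ^ 'n" where
  "matrix_power A 0 = mat 1"
| "matrix_power A (Suc k) = A ** matrix_power A k"

definition matrix_exp :: "real ^ 'n ^ 'n \<Rightarrow> real ^ 'n ^ 'n" where
  "matrix_exp A = (\<Sum>k. (1 / fact k) *\<^sub>R matrix_power A k)"

definition matrix_kernel :: "real ^ 'n ^ 'm \<Rightarrow> (real ^ 'n) set" where
  "matrix_kernel A = {v. A *v v = 0}"

definition unobservable_subspace :: "real ^ 'n ^ 'p \<Rightarrow> real ^ 'n ^ 'n \<Rightarrow> (real ^ 'n) set" where
  "unobservable_subspace C A = (\<Inter>i\<in>{0..<CARD('n)}. matrix_kernel (C ** matrix_power A i))"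

definition trajectory :: "real ^ 'n ^ 'n \<Rightarrow> real ^ 'n \<Rightarrow> real \<Rightarrow> real ^ 'n" where
  "trajectory X x0 t = matrix_exp (t *\<^sub>R X) *v x0"

text \<open>At the endpoints of \<open>[0, T]\<close> the derivative is one-sided.\<close>

definition is_solution_on :: "real set \<Rightarrow> real ^ 'n ^ 'n \<Rightarrow> (real \<Rightarrow> real ^ 'n) \<Rightarrow> bool" where
  "is_solution_on S X x \<longleftrightarrow> (\<forall>t\<in>S. (x has_vector_derivative X *v x t) (at t within S))"

definition reconstruction_solvable ::
  "real \<Rightarrow> real ^ 'n \<Rightarrow> real ^ 'n ^ 'n \<Rightarrow> (('n \<times> 'n) set \<Rightarrow> (real ^ 'n ^ 'n) set) \<Rightarrow> bool" where
  "reconstruction_solvable T x0 X K \<longleftrightarrow>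
    (\<forall>X'\<in>map_image K. is_solution_on {0..T} X' (trajectory X x0) \<longrightarrow> X' = X)"

end

theory Submission
  imports Defs
begin

text \<open>
  Along \<open>x(t) = e\<^sup>X\<^sup>t x\<^sub>0\<close>, being a solution for \<open>X'\<close> on \<open>[0, T]\<close> means \<open>C x(t) = 0\<close> there, where
  \<open>C = X' - X\<close>. Differentiating repeatedly and evaluating at \<open>t = 0\<close> gives \<open>C X\<^sup>k x\<^sub>0 = 0\<close> for all
  \<open>k\<close>; the exponential series gives the converse. Only \<open>k < n\<close> matters, because some
  \<open>X\<^sup>m x\<^sub>0\<close> with \<open>m \<le> n\<close> depends linearly on the preceding Krylov vectors, whose span is then
  invariant under \<open>X\<close>.
\<close>

lemma bounded_bilinear_matrix_matrix_mult:
  "bounded_bilinear ((**) :: real ^ 'n::finite ^ 'm::finite \<Rightarrow> real ^ 'p::finite ^ 'n \<Rightarrow> real ^ 'p ^ 'm)"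
  unfolding bilinear_conv_bounded_bilinear[symmetric] bilinear_def
  by (intro conjI allI linearI)
    (simp_all add: matrix_matrix_mult_def vec_eq_iff sum.distrib algebra_simps sum_distrib_left)

text \<open>Lets the exponential series of matrices be applied to \<open>x0\<close> term by
  term.\<close>

lemma linear_matrix_vector_mult_left:
  "linear (\<lambda>A :: real ^ 'n::finite ^ 'm. A *v x)"
  by (intro linearI) (simp_all add: matrix_vector_mult_add_rdistrib scaleR_matrix_vector_assoc)

lemma matrix_power_scaleR:
  fixes A :: "real ^ 'n::finite ^ 'n"
  shows "matrix_power (t *\<^sub>R A) k = t ^ k *\<^sub>R matrix_power A k"
proof (induction k)
  case (Suc k)
  then show ?case
    by (simp add: bounded_bilinear.scaleR_left[OF bounded_bilinear_matrix_matrix_mult]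
        bounded_bilinear.scaleR_right[OF bounded_bilinear_matrix_matrix_mult])
qed simp

text \<open>Comparison with the scalar exponential series at \<open>L\<close>. The constant
  \<open>K\<close> of the bilinear bound is absorbed into \<open>L\<close>, and the norm of the
  identity stays as a factor since it need not be 1.\<close>

lemma summable_matrix_exp:
  fixes A :: "real ^ 'n::finite ^ 'n"
  shows "summable (\<lambda>k. (1 / fact k) *\<^sub>R matrix_power A k)"
proof -
  obtain K where K: "\<And>B (D :: real ^ 'n ^ 'n). norm ((B :: real ^ 'n ^ 'n) ** D) \<le> norm B * norm D * K" and "K > 0"
    using bounded_bilinear.pos_bounded[OF bounded_bilinear_matrix_matrix_mult] by metis
  define L where "L = norm A * K"
  have "L \<ge> 0" using \<open>K > 0\<close> by (simp add: L_def)
  have bound: "norm (matrix_power A k) \<le> L ^ k * norm (mat 1 :: real ^ 'n ^ 'n)" for k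
  proof (induction k)
    case (Suc k)
    have "norm (matrix_power A (Suc k)) \<le> L * norm (matrix_power A k)"
      using K[of A "matrix_power A k"] by (simp add: L_def mult_ac)
    also have "\<dots> \<le> L * (L ^ k * norm (mat 1 :: real ^ 'n ^ 'n))"
      using Suc \<open>L \<ge> 0\<close> by (rule mult_left_mono)
    finally show ?case by (simp add: mult_ac)
  qed simp
  have "summable (\<lambda>k. inverse (fact k) * L ^ k * norm (mat 1 :: real ^ 'n ^ 'n))"
    by (intro summable_mult2 summable_exp)
  then show ?thesis
  proof (rule summable_comparison_test'[where N = 0])
    fix k
    show "norm ((1 / fact k) *\<^sub>R matrix_power A k)
        \<le> inverse (fact k) * L ^ k * norm (mat 1 :: real ^ 'n ^ 'n)"
      using mult_left_mono[OF bound[of k], of "inverse (fact k)"]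
      by (simp add: divide_inverse mult_ac)
  qed
qed

lemma trajectory_sums:
  fixes X :: "real ^ 'n::finite ^ 'n"
  shows "(\<lambda>k. (t ^ k / fact k) *\<^sub>R (matrix_power X k *v x0)) sums trajectory X x0 t"
proof -
  have "(\<lambda>k. ((1 / fact k) *\<^sub>R matrix_power (t *\<^sub>R X) k) *v x0) sums trajectory X x0 t"
    unfolding trajectory_def matrix_exp_def
    using bounded_linear.sums[OF linear_linear[THEN iffD2, OF linear_matrix_vector_mult_left]
        summable_sums[OF summable_matrix_exp]] .
  then show ?thesis
    by (simp add: matrix_power_scaleR scaleR_matrix_vector_assoc[symmetric])
qed

lemma bounded_linear_trajectory_sums:
  fixes X :: "real ^ 'n::finite ^ 'n"
  assumes "bounded_linear f"
  shows "(\<lambda>k. (t ^ k / fact k) *\<^sub>R f (matrix_power X k *v x0)) sums f (trajectory X x0 t)"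
  using bounded_linear.sums[OF assms trajectory_sums]
  by (simp add: linear_simps[OF assms])

lemma trajectory_0 [simp]:
  fixes X :: "real ^ 'n::finite ^ 'n"
  shows "trajectory X x0 0 = x0"
proof -
  \<comment> \<open>As \<open>0 ^ 0 = 1\<close>, the term with index 0 survives at time 0.\<close>
  have "(\<lambda>k. if k = 0 then x0 else 0) sums trajectory X x0 0"
    using trajectory_sums[of 0 X x0]
    by (rule back_subst[of "\<lambda>f. f sums _"]) (auto simp: fun_eq_iff)
  then show ?thesis
    using sums_single[of 0 "\<lambda>_. x0"] sums_unique2 by fast
qed

text \<open>Each component is a scalar power series converging everywhere, so it may be
  differentiated termwise.\<close>

lemma trajectory_has_vector_derivative:
  fixes X :: "real ^ 'n::finite ^ 'n"
  shows "(trajectory X x0 has_vector_derivative X *v trajectory X x0 t) (at t within S)"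
proof -
  have "((\<lambda>s. trajectory X x0 s \<bullet> b) has_field_derivative (X *v trajectory X x0 t) \<bullet> b) (at t)" for b
  proof -
    define c where "c k = (matrix_power X k *v x0) \<bullet> b / fact k" for k
    have c: "(\<lambda>k. c k * s ^ k) sums (trajectory X x0 s \<bullet> b)" for s
      using bounded_linear_trajectory_sums[OF bounded_linear_inner_left]
      by (simp add: c_def mult_ac)
    have "(\<lambda>k. (t ^ k / fact k) *\<^sub>R ((X *v (matrix_power X k *v x0)) \<bullet> b))
        sums ((X *v trajectory X x0 t) \<bullet> b)"
      by (rule bounded_linear_trajectory_sums)
        (intro bounded_linear_inner_left_comp matrix_vector_mul_bounded_linear)
    then have "(\<lambda>k. diffs c k * t ^ k) sums ((X *v trajectory X x0 t) \<bullet> b)"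
      \<comment> \<open>\<open>diffs\<close> multiplies the next coefficient by
        \<open>Suc k\<close>, which cancels against \<open>fact (Suc k)\<close>. Keeping
        \<open>of_nat (Suc k)\<close> folded makes this cancellation visible.\<close>
      by (simp add: diffs_def c_def matrix_vector_mul_assoc mult_ac del: of_nat_Suc)
    then show ?thesis
      using termdiffs_strong_converges_everywhere[of c t] c
      by (simp add: sums_iff)
  qed
  then show ?thesis
    unfolding has_vector_derivative_def has_derivative_componentwise_within[of "trajectory X x0"]
    by (simp add: has_field_derivative_def has_derivative_at_withinI mult_commute_abs)
qed

lemma matrix_trajectory_eq_0_iff:
  fixes X :: "real ^ 'n::finite ^ 'n" and C :: "real ^ 'n ^ 'm::finite"
  assumes "T > 0"
  shows "(\<forall>t\<in>{0..T}. C *v trajectory X x0 t = 0) \<longleftrightarrow> (\<forall>k. C *v (matrix_power X k *v x0) = 0)"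
proof
  assume zero: "\<forall>t\<in>{0..T}. C *v trajectory X x0 t = 0"
  \<comment> \<open>Stated for arbitrary \<open>D\<close> because the induction below uses it with
    \<open>C ** matrix_power X k\<close>. A function vanishing on the interval has derivative 0
    within it, and \<open>T > 0\<close> makes that derivative unique even at the endpoints.\<close>
  have mult_X: "D *v (X *v trajectory X x0 t) = 0"
    if D: "\<forall>t\<in>{0..T}. D *v trajectory X x0 t = 0" and t: "t \<in> {0..T}"
    for D :: "real ^ 'n ^ 'm" and t
  proof (rule vector_derivative_unique_within_closed_interval)
    show "0 < T" "t \<in> cbox 0 T" using assms t by auto
    show "((\<lambda>s. D *v trajectory X x0 s) has_vector_derivative D *v (X *v trajectory X x0 t))
        (at t within cbox 0 T)"
      by (rule bounded_linear.has_vector_derivative[OF matrix_vector_mul_bounded_linear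
          trajectory_has_vector_derivative])
    show "((\<lambda>s. D *v trajectory X x0 s) has_vector_derivative 0) (at t within cbox 0 T)"
      by (rule has_vector_derivative_transform[of _ _ _ "\<lambda>_. 0"]) (use D t in auto)
  qed
  have "\<forall>t\<in>{0..T}. (C ** matrix_power X k) *v trajectory X x0 t = 0" for k
  proof (induction k)
    case (Suc k)
    \<comment> \<open>Differentiation puts the new factor \<open>X\<close> on the right, whereas
      \<open>matrix_power\<close> puts it on the left.\<close>
    have "matrix_power X k ** X = X ** matrix_power X k"
      by (induction k) (simp_all add: matrix_mul_assoc[symmetric])
    then show ?case
      using mult_X[OF Suc] by (simp add: matrix_vector_mul_assoc matrix_mul_assoc[symmetric])
  qed (use zero in simp)
  from this[THEN bspec, of 0] show "\<forall>k. C *v (matrix_power X k *v x0) = 0"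
    using assms by (simp add: matrix_vector_mul_assoc)
next
  assume "\<forall>k. C *v (matrix_power X k *v x0) = 0"
  then have "(\<lambda>_. 0) sums (C *v trajectory X x0 t)" for t
    using bounded_linear_trajectory_sums[OF matrix_vector_mul_bounded_linear[of C], of t X x0] by simp
  then show "\<forall>t\<in>{0..T}. C *v trajectory X x0 t = 0"
    using sums_0 sums_unique2 by blast
qed

text \<open>Otherwise the vectors \<open>u 0\<close>, ..., \<open>u DIM('a)\<close> would be
  independent, one more than the dimension allows.\<close>

lemma exists_mem_span_previous:
  fixes u :: "nat \<Rightarrow> 'a::euclidean_space"
  shows "\<exists>m\<le>DIM('a). u m \<in> span (u ` {..<m})"
proof (rule ccontr)
  assume "\<not> ?thesis"
  then have new: "u m \<notin> span (u ` {..<m})" if "m \<le> DIM('a)" for m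
    using that by blast
  \<comment> \<open>The cardinality is carried along because an image set would hide repetitions
    among the \<open>u i\<close>.\<close>
  have "m \<le> Suc (DIM('a)) \<Longrightarrow> independent (u ` {..<m}) \<and> card (u ` {..<m}) = m" for m
  proof (induction m)
    case 0
    show ?case by (simp add: independent_empty)
  next
    case (Suc m)
    then have "u m \<notin> span (u ` {..<m})" using new by simp
    then show ?case
      using Suc span_base[of "u m" "u ` {..<m}"]
      by (auto simp: lessThan_Suc independent_insert)
  qed
  from this[of "Suc (DIM('a))"] show False
    using independent_bound[of "u ` {..<Suc (DIM('a))}"] by simp
qed

text \<open>Does the work of the Cayley-Hamilton theorem, for a single starting vector.\<close>

lemma matrix_power_mem_span:
  fixes X :: "real ^ 'n::finite ^ 'n"
  shows "matrix_power X k *v x0 \<in> span ((\<lambda>i. matrix_power X i *v x0) ` {..<CARD('n)})"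
proof -
  define u where "u i = matrix_power X i *v x0" for i
  have u_Suc: "X *v u i = u (Suc i)" for i
    by (simp add: u_def matrix_vector_mul_assoc)
  obtain m where m: "m \<le> CARD('n)" "u m \<in> span (u ` {..<m})"
    using exists_mem_span_previous[of u] by auto
  have step: "X *v v \<in> span (u ` {..<m})" if "v \<in> span (u ` {..<m})" for v
  proof -
    have "X *v v \<in> span ((*v) X ` u ` {..<m})"
      using that linear_span_image[OF matrix_vector_mul_linear, of X "u ` {..<m}"] by blast
    also have "\<dots> \<subseteq> span (u ` {..<m})"
    proof (rule span_minimal)
      show "(*v) X ` u ` {..<m} \<subseteq> span (u ` {..<m})"
      proof clarsimp
        fix i assume "i < m"
        then show "X *v u i \<in> span (u ` {..<m})"
          \<comment> \<open>The successor of the last index gives \<open>u m\<close>, which lies in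
            the span by the choice of \<open>m\<close>; every other successor is still below
            \<open>m\<close>.\<close>
          using m by (cases "Suc i = m") (auto simp: u_Suc intro!: span_base)
      qed
    qed simp
    finally show ?thesis .
  qed
  have "u k \<in> span (u ` {..<m})"
  proof (induction k)
    case 0
    show ?case
      \<comment> \<open>For \<open>m = 0\<close> the choice of \<open>m\<close> itself puts
        \<open>u 0\<close> into the span of the empty set.\<close>
      using m by (cases "m = 0") (auto intro!: span_base)
  next
    case (Suc k)
    then show ?case using step u_Suc by metis
  qed
  moreover have "span (u ` {..<m}) \<subseteq> span (u ` {..<CARD('n)})"
    using m by (intro span_mono image_mono) auto
  ultimately show ?thesis unfolding u_def by blast
qed

text \<open>The kernel of \<open>C\<close> is a subspace, so once it contains the first
  \<open>CARD('n)\<close> Krylov vectors it contains their span, hence all of them.\<close>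

lemma mem_unobservable_subspace_iff:
  fixes X :: "real ^ 'n::finite ^ 'n" and C :: "real ^ 'n ^ 'm"
  shows "x0 \<in> unobservable_subspace C X \<longleftrightarrow> (\<forall>k. C *v (matrix_power X k *v x0) = 0)"
proof
  assume "x0 \<in> unobservable_subspace C X"
  then have "(\<lambda>i. matrix_power X i *v x0) ` {..<CARD('n)} \<subseteq> matrix_kernel C"
    by (auto simp: unobservable_subspace_def matrix_kernel_def matrix_vector_mul_assoc)
  moreover have "subspace (matrix_kernel C)"
    unfolding matrix_kernel_def by (rule linear_subspace_kernel) (rule matrix_vector_mul_linear)
  ultimately have "span ((\<lambda>i. matrix_power X i *v x0) ` {..<CARD('n)}) \<subseteq> matrix_kernel C"
    by (rule span_minimal)
  then show "\<forall>k. C *v (matrix_power X k *v x0) = 0"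
    using matrix_power_mem_span by (force simp: matrix_kernel_def)
next
  assume "\<forall>k. C *v (matrix_power X k *v x0) = 0"
  then show "x0 \<in> unobservable_subspace C X"
    by (simp add: unobservable_subspace_def matrix_kernel_def matrix_vector_mul_assoc)
qed

text \<open>The trajectory already solves the system of \<open>X\<close>, and derivatives within a
  nondegenerate interval are unique, so the two right-hand sides must agree at each time.\<close>

lemma is_solution_on_trajectory_iff:
  fixes X X' :: "real ^ 'n::finite ^ 'n"
  assumes "T > 0"
  shows "is_solution_on {0..T} X' (trajectory X x0) \<longleftrightarrow>
    (\<forall>t\<in>{0..T}. (X' - X) *v trajectory X x0 t = 0)"
proof -
  have "(trajectory X x0 has_vector_derivative X' *v trajectory X x0 t) (at t within {0..T}) \<longleftrightarrow>
      X' *v trajectory X x0 t = X *v trajectory X x0 t" if "t \<in> {0..T}" for t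
    using vector_derivative_unique_within_closed_interval[of 0 T t "trajectory X x0"]
      trajectory_has_vector_derivative[of X x0 t "{0..T}"] assms that
    by auto
  then show ?thesis
    by (simp add: is_solution_on_def matrix_vector_mult_diff_rdistrib)
qed

theorem theorem4:
  fixes T :: real
    and G :: "('n::finite \<times> 'n) set"
    and K :: "('n \<times> 'n) set \<Rightarrow> (real ^ 'n ^ 'n) set"
    and X :: "real ^ 'n ^ 'n"
    and x0 :: "real ^ 'n"
  assumes "T > 0"
    and "G \<in> simple_graphs"
    and "\<And>H. H \<in> simple_graphs \<Longrightarrow> K H \<noteq> {} \<and> K H \<subseteq> qualitative_class H"
    and "X \<in> K G"
  shows "reconstruction_solvable T x0 X K \<longleftrightarrow>
    (\<forall>X' \<in> map_image K - {X}. x0 \<notin> unobservable_subspace (X' - X) X)"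
  \<comment> \<open>Both sides now use the same condition on all powers of \<open>X\<close>, and
    they are contrapositives of each other for each \<open>X'\<close>.\<close>
  unfolding reconstruction_solvable_def is_solution_on_trajectory_iff[OF assms(1)]
    matrix_trajectory_eq_0_iff[OF assms(1)] mem_unobservable_subspace_iff
  by blast

end
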